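(* Assume $c<3$. Then the curvature 2-form $F_c=d\Theta_c$ on $\mathcal M$ satisfies $$N_c^2F_c=G_c+\widetilde{G_c},$$ $$G_c=8(3-c)\frac{v^2}{u}\{\mathbf u,d\mathbf u,d\mathbf u\}+4(1-c)\Big[du\wedge\{\mathbf u,\mathbf v,d\mathbf v\}+u\{\mathbf v,d\mathbf u,d\mathbf v\}\Big],$$ where $\widetilde{G_c}$ is obtained from $G_c$ by interchanging $\mathbf u\leftrightarrow\mathbf v$ and $u\leftrightarrow v$.
   Context: Let $x_0,\dots,x_7$ be the standard coordinates on $\mathbb R^8$, with partial derivatives $\partial_i$, and let $e=\sum_i dx_i\otimes dx_i$ and $R=\sum_i x_i^2$. Put $X=-x_1\partial_0+x_0\partial_1-x_3\partial_2+x_2\partial_3-x_5\partial_4+x_4\partial_5-x_7\partial_6+x_6\partial_7$, $Y_1=-x_1\partial_0+x_0\partial_1+x_3\partial_2-x_2\partial_3-x_5\partial_4+x_4\partial_5+x_7\partial_6-x_6\partial_7$, $Y_2=-x_2\partial_0+x_0\partial_2+x_1\partial_3-x_3\partial_1-x_6\partial_4+x_4\partial_6+x_5\partial_7-x_7\partial_5$, $Y_3=-x_3\partial_0+x_0\partial_3+x_2\partial_1-x_1\partial_2-x_7\partial_4+x_4\partial_7+x_6\partial_5-x_5\partial_6$, and $\alpha_i=e(Y_i,\cdot)$. The flow of $Y_1$ is a free circle action on $\mathbb R^8\setminus0$ with quotient $\mathcal C=\mathbb R^+\times\mathbb{CP}^3$; tensors on $\mathcal C$ are identified with their pullbacks to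 $\mathbb R^8\setminus 0$. For $c<3$, $h_c=\tfrac12dR^2+2R\,e-2\alpha_1^2+(1-c)(\alpha_2^2+\alpha_3^2)$ defines a Riemannian metric on $\mathcal C$. The vector field $X$ generates a circle action on $\mathcal C$; its quotient is $Q:\mathcal C\to\mathcal M\cong\mathbb R^6\setminus0$, with coordinates $(\mathbf u,\mathbf v)=(u_1,u_2,u_3;v_1,v_2,v_3)$ given by $u_1=x_0^2+x_1^2-x_4^2-x_5^2$, $u_2=2(x_0x_4+x_1x_5)$, $u_3=2(x_0x_5-x_1x_4)$, $v_1=x_2^2+x_3^2-x_6^2-x_7^2$, $v_2=2(x_2x_6+x_3x_7)$, $v_3=2(x_2x_7-x_3x_6)$. Also $u=|\mathbf u|$, $v=|\mathbf v|$, $R=u+v$. Let $N_c=h_c(X,X)=2(5-c)uv+2(1-c)\,\mathbf u\cdot\mathbf v$ and $\Theta_c=\frac{2}{N_c}h_c(X,\cdot)$, a connection form for $Q$ over the locus $uv\neq0$. The 2-form $F_c=d\Theta_c$ on $\mathcal C$ descends to the locus $uv\ne0$ of $\mathcal M$. Triple products: for vector-valued functions or 1-forms $\mathbf a,\mathbf b,\mathbf c$, $\{\mathbf a,\mathbf b,\mathbf c\}=\sum_{i,j,k}\epsilon_{ijk}\,a_i\wedge b_j\wedge c_k$ ($\epsilon_{ijk}$ the alternating symbol). For instance $\{\mathbf u,\mathbf v,d\mathbf u\}=(u_2v_3-u_3v_2)du_1+\cdots$, $\{\mathbf u,d\mathbf u,d\mathbf u\}=2u_1\,du_2\wedge du_3+\cdots$,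 $\{\mathbf u,d\mathbf u,d\mathbf v\}=u_1(du_2\wedge dv_3-du_3\wedge dv_2)+\cdots$, the dots denoting cyclic permutations of indices.
   Formalization: The bracket in G_c carries the coefficient 4(1-c)(3-c) instead of the printed 4(1-c); with the printed coefficient the formula is false unless c=1 or c=2 (e.g. c=0, x=(1,0,1,0,0,0,1,0), vectors ∂_5 and ∂_2-∂_6: left side 192, right side 64). *)

theory Defs
  imports "HOL-Analysis.Analysis"
begin

section \<open>Pointwise exterior calculus\<close>

text \<open>
  A \<open>k\<close>-form on a normed space assigns to a point and \<open>k\<close> tangent vectors a real number.
  The normalisation is \<open>\<alpha> \<and> \<beta> = \<alpha> \<otimes> \<beta> - \<beta> \<otimes> \<alpha>\<close> and, for constant vectors \<open>a\<close> and \<open>b\<close>,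
  \<open>d\<alpha>(a, b) = a(\<alpha>(b)) - b(\<alpha>(a))\<close>.
\<close>

type_synonym 'a form1 = "'a \<Rightarrow> 'a \<Rightarrow> real"
type_synonym 'a form2 = "'a \<Rightarrow> 'a \<Rightarrow> 'a \<Rightarrow> real"

definition d0 :: "('a::real_normed_vector \<Rightarrow> real) \<Rightarrow> 'a form1"
  where "d0 f p a = frechet_derivative f (at p) a"

definition d1 :: "'a::real_normed_vector form1 \<Rightarrow> 'a form2"
  where "d1 \<omega> p a b =
    frechet_derivative (\<lambda>q. \<omega> q b) (at p) a - frechet_derivative (\<lambda>q. \<omega> q a) (at p) b"

definition wedge :: "'a form1 \<Rightarrow> 'a form1 \<Rightarrow> 'a form2"
  where "wedge \<alpha> \<beta> p a b = \<alpha> p a * \<beta> p b - \<alpha> p b * \<beta> p a"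

definition pullback2 ::
  "('a::real_normed_vector \<Rightarrow> 'b::real_normed_vector) \<Rightarrow> 'b form2 \<Rightarrow> 'a form2"
  where "pullback2 f \<omega> x a b =
    \<omega> (f x) (frechet_derivative f (at x) a) (frechet_derivative f (at x) b)"

definition is_form2_on :: "'a::real_vector set \<Rightarrow> 'a form2 \<Rightarrow> bool"
  where "is_form2_on S \<omega> \<longleftrightarrow>
    (\<forall>p\<in>S. (\<forall>a. linear (\<omega> p a)) \<and> (\<forall>b. linear (\<lambda>a. \<omega> p a b)) \<and> (\<forall>a. \<omega> p a a = 0))"

definition dvec :: "('a::real_normed_vector \<Rightarrow> real^3) \<Rightarrow> 3 \<Rightarrow> 'a form1"
  where "dvec \<phi> i = d0 (\<lambda>p. \<phi> p $ i)"

definition eps :: "3 \<Rightarrow> 3 \<Rightarrow> 3 \<Rightarrow> real"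
  where "eps i j k =
    (if (i, j, k) \<in> {(1, 2, 3), (2, 3, 1), (3, 1, 2)} then 1
     else if (i, j, k) \<in> {(3, 2, 1), (2, 1, 3), (1, 3, 2)} then -1
     else 0)"

text \<open>
  The triple products \<open>{a, b, \<gamma>}\<close> and \<open>{a, \<beta>, \<gamma>}\<close>, where \<open>a\<close>, \<open>b\<close> are vector-valued functions and
  \<open>\<beta>\<close>, \<open>\<gamma>\<close> are vector-valued 1-forms.
\<close>

definition triple1 ::
  "('a \<Rightarrow> real^3) \<Rightarrow> ('a \<Rightarrow> real^3) \<Rightarrow> (3 \<Rightarrow> 'a form1) \<Rightarrow> 'a form1"
  where "triple1 a b \<gamma> p w =
    (\<Sum>i\<in>UNIV. \<Sum>j\<in>UNIV. \<Sum>k\<in>UNIV. eps i j k * (a p $ i * b p $ j * \<gamma> k p w))"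

definition triple2 ::
  "('a \<Rightarrow> real^3) \<Rightarrow> (3 \<Rightarrow> 'a form1) \<Rightarrow> (3 \<Rightarrow> 'a form1) \<Rightarrow> 'a form2"
  where "triple2 a \<beta> \<gamma> p w z =
    (\<Sum>i\<in>UNIV. \<Sum>j\<in>UNIV. \<Sum>k\<in>UNIV. eps i j k * (a p $ i * wedge (\<beta> j) (\<gamma> k) p w z))"


section \<open>Vector fields and the tensors \<open>h\<^sub>c\<close> on \<open>\<real>\<^sup>8\<close>\<close>

text \<open>
  The coordinates are \<open>x $ 0, \<dots>, x $ 7\<close>; the eight elements of the index type \<open>8\<close> are
  \<open>0, \<dots>, 7\<close>. Tensors on the quotient \<open>\<C>\<close> of \<open>\<real>\<^sup>8 - {0}\<close> by the flow of \<open>Y1\<close> are represented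
  by their pullbacks to \<open>\<real>\<^sup>8\<close>.
\<close>

abbreviation pd :: "8 \<Rightarrow> real^8"
  where "pd i \<equiv> axis i 1"

definition X :: "real^8 \<Rightarrow> real^8"
  where "X x = - (x$1) *\<^sub>R pd 0 + (x$0) *\<^sub>R pd 1 - (x$3) *\<^sub>R pd 2 + (x$2) *\<^sub>R pd 3
             - (x$5) *\<^sub>R pd 4 + (x$4) *\<^sub>R pd 5 - (x$7) *\<^sub>R pd 6 + (x$6) *\<^sub>R pd 7"

definition Y1 :: "real^8 \<Rightarrow> real^8"
  where "Y1 x = - (x$1) *\<^sub>R pd 0 + (x$0) *\<^sub>R pd 1 + (x$3) *\<^sub>R pd 2 - (x$2) *\<^sub>R pd 3
              - (x$5) *\<^sub>R pd 4 + (x$4) *\<^sub>R pd 5 + (x$7) *\<^sub>R pd 6 - (x$6) *\<^sub>R pd 7"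

definition Y2 :: "real^8 \<Rightarrow> real^8"
  where "Y2 x = - (x$2) *\<^sub>R pd 0 + (x$0) *\<^sub>R pd 2 + (x$1) *\<^sub>R pd 3 - (x$3) *\<^sub>R pd 1
              - (x$6) *\<^sub>R pd 4 + (x$4) *\<^sub>R pd 6 + (x$5) *\<^sub>R pd 7 - (x$7) *\<^sub>R pd 5"

definition Y3 :: "real^8 \<Rightarrow> real^8"
  where "Y3 x = - (x$3) *\<^sub>R pd 0 + (x$0) *\<^sub>R pd 3 + (x$2) *\<^sub>R pd 1 - (x$1) *\<^sub>R pd 2
              - (x$7) *\<^sub>R pd 4 + (x$4) *\<^sub>R pd 7 + (x$6) *\<^sub>R pd 5 - (x$5) *\<^sub>R pd 6"

definition R :: "real^8 \<Rightarrow> real"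
  where "R x = (\<Sum>i\<in>UNIV. (x$i)\<^sup>2)"

definition e :: "real^8 \<Rightarrow> real^8 \<Rightarrow> real"
  where "e a b = (\<Sum>i\<in>UNIV. a$i * b$i)"

definition \<alpha>1 :: "(real^8) form1" where "\<alpha>1 x a = e (Y1 x) a"
definition \<alpha>2 :: "(real^8) form1" where "\<alpha>2 x a = e (Y2 x) a"
definition \<alpha>3 :: "(real^8) form1" where "\<alpha>3 x a = e (Y3 x) a"

text \<open>Squares of 1-forms are symmetric tensor squares; in particular \<open>dR\<^sup>2\<close> is \<open>dR \<otimes> dR\<close>.\<close>

definition h :: "real \<Rightarrow> real^8 \<Rightarrow> real^8 \<Rightarrow> real^8 \<Rightarrow> real"
  where "h c x a b = 1/2 * (d0 R x a * d0 R x b) + 2 * R x * e a b - 2 * (\<alpha>1 x a * \<alpha>1 x b)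
    + (1 - c) * (\<alpha>2 x a * \<alpha>2 x b + \<alpha>3 x a * \<alpha>3 x b)"

definition \<Theta> :: "real \<Rightarrow> (real^8) form1"
  where "\<Theta> c x a = 2 / h c x (X x) (X x) * h c x (X x) a"


section \<open>The quotient map and the base\<close>

text \<open>A point of the base is a pair \<open>(\<^bold>u, \<^bold>v)\<close>; its coordinates \<open>\<^bold>u\<close>, \<open>\<^bold>v\<close> are \<open>fst\<close>, \<open>snd\<close>.\<close>

type_synonym base = "(real^3) \<times> (real^3)"

definition Q :: "real^8 \<Rightarrow> base"
  where "Q x =
    (vector [(x$0)\<^sup>2 + (x$1)\<^sup>2 - (x$4)\<^sup>2 - (x$5)\<^sup>2,
             2 * (x$0 * x$4 + x$1 * x$5),
             2 * (x$0 * x$5 - x$1 * x$4)],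
     vector [(x$2)\<^sup>2 + (x$3)\<^sup>2 - (x$6)\<^sup>2 - (x$7)\<^sup>2,
             2 * (x$2 * x$6 + x$3 * x$7),
             2 * (x$2 * x$7 - x$3 * x$6)])"

definition locus :: "base set"
  where "locus = {p. norm (fst p) * norm (snd p) \<noteq> 0}"

definition N :: "real \<Rightarrow> base \<Rightarrow> real"
  where "N c p = 2 * (5 - c) * norm (fst p) * norm (snd p) + 2 * (1 - c) * (fst p \<bullet> snd p)"

definition descends_to :: "(real^8) form2 \<Rightarrow> base form2 \<Rightarrow> bool"
  where "descends_to \<omega> F \<longleftrightarrow>
    is_form2_on locus F \<and> (\<forall>x\<in>Q -` locus. pullback2 Q F x = \<omega> x)"

text \<open>
  Interchanging \<open>\<^bold>u\<close> and \<open>\<^bold>v\<close> (and \<open>u\<close> and \<open>v\<close>) in \<open>G c fst snd\<close> gives \<open>G c snd fst\<close>.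

  The coefficient of the bracket is \<open>4 (1 - c) (3 - c)\<close>. With \<open>4 (1 - c)\<close> alone the curvature
  formula fails unless \<open>c = 1\<close> or \<open>c = 2\<close>: for \<open>c = 0\<close> at \<open>x = \<partial>\<^sub>0 + \<partial>\<^sub>2 + \<partial>\<^sub>6\<close>, evaluation on
  \<open>(\<partial>\<^sub>5, \<partial>\<^sub>2 - \<partial>\<^sub>6)\<close> gives \<open>N\<^sup>2 d\<Theta> = 192\<close>, while the first terms of \<open>G\<close> and of its interchange
  vanish and their brackets add up to \<open>16\<close>.
\<close>

definition G :: "real \<Rightarrow> (base \<Rightarrow> real^3) \<Rightarrow> (base \<Rightarrow> real^3) \<Rightarrow> base form2"
  where "G c bu bv p w z =
    (let u = (\<lambda>q. norm (bu q)); v = (\<lambda>q. norm (bv q)) in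
      8 * (3 - c) * ((v p)\<^sup>2 / u p) * triple2 bu (dvec bu) (dvec bu) p w z
      + 4 * (1 - c) * (3 - c) *
        (wedge (d0 u) (triple1 bu bv (dvec bv)) p w z
         + u p * triple2 bv (dvec bu) (dvec bv) p w z))"


section \<open>\<open>h\<^sub>c(X, X)\<close> as a function on the base\<close>

lemma exhaust_8: "(x::8) = 0 \<or> x = 1 \<or> x = 2 \<or> x = 3 \<or> x = 4 \<or> x = 5 \<or> x = 6 \<or> x = 7"
proof (induct x)
  case (of_int z)
  then have "0 \<le> z" and "z < 8" by simp_all
  then have "z = 0 \<or> z = 1 \<or> z = 2 \<or> z = 3 \<or> z = 4 \<or> z = 5 \<or> z = 6 \<or> z = 7" by arith
  then show ?case by auto
qed

lemma UNIV_8: "(UNIV :: 8 set) = {0, 1, 2, 3, 4, 5, 6, 7}"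
  using exhaust_8 by auto

lemma sum_8: "sum f (UNIV :: 8 set) = f 0 + f 1 + f 2 + f 3 + f 4 + f 5 + f 6 + f 7"
  unfolding UNIV_8 by (simp add: ac_simps)

lemma d0_R: "d0 R x a = 2 * e x a"
proof -
  have "(R has_derivative (\<lambda>a. 2 * e x a)) (at x)"
    unfolding R_def[abs_def] e_def
    by (auto intro!: derivative_eq_intros bounded_linear_imp_has_derivative sum.cong simp: sum_distrib_left)
  then show ?thesis by (simp add: d0_def frechet_derivative_at[symmetric])
qed

lemma norm_fst_Q: "norm (fst (Q x)) = (x$0)\<^sup>2 + (x$1)\<^sup>2 + (x$4)\<^sup>2 + (x$5)\<^sup>2"
proof -
  have "(norm (fst (Q x)))\<^sup>2 = ((x$0)\<^sup>2 + (x$1)\<^sup>2 + (x$4)\<^sup>2 + (x$5)\<^sup>2)\<^sup>2"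
    by (simp add: Q_def power2_norm_eq_inner inner_vec_def sum_3) algebra
  then show ?thesis by (simp add: power2_eq_iff_nonneg)
qed

lemma norm_snd_Q: "norm (snd (Q x)) = (x$2)\<^sup>2 + (x$3)\<^sup>2 + (x$6)\<^sup>2 + (x$7)\<^sup>2"
proof -
  have "(norm (snd (Q x)))\<^sup>2 = ((x$2)\<^sup>2 + (x$3)\<^sup>2 + (x$6)\<^sup>2 + (x$7)\<^sup>2)\<^sup>2"
    by (simp add: Q_def power2_norm_eq_inner inner_vec_def sum_3) algebra
  then show ?thesis by (simp add: power2_eq_iff_nonneg)
qed

lemma sum_of_squares_identity: 
  fixes x0 :: real
  shows "(2 * (x1 * x2 - x0 * x3 + x5 * x6 - x4 * x7))\<^sup>2 + (2 * (x0 * x2 + x1 * x3 + x4 * x6 + x5 * x7))\<^sup>2 =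
 2 * (x0\<^sup>2+x1\<^sup>2+x4\<^sup>2+x5\<^sup>2)*(x2\<^sup>2+x3\<^sup>2+x6\<^sup>2+x7\<^sup>2) + 2*((x0\<^sup>2 + x1\<^sup>2 - x4\<^sup>2 - x5\<^sup>2) * (x2\<^sup>2 + x3\<^sup>2 - x6\<^sup>2 - x7\<^sup>2)
    + 2 * (x0 * x4 + x1 * x5) * (2 * (x2 * x6 + x3 * x7))
    + 2 * (x0 * x5 - x1 * x4) * (2 * (x2 * x7 - x3 * x6)))"
  by (simp add: field_simps power2_eq_square)

lemma inner_Q: "fst (Q x) \<bullet> snd (Q x) =
    ((x$0)\<^sup>2 + (x$1)\<^sup>2 - (x$4)\<^sup>2 - (x$5)\<^sup>2) * ((x$2)\<^sup>2 + (x$3)\<^sup>2 - (x$6)\<^sup>2 - (x$7)\<^sup>2)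
    + 2 * (x$0 * x$4 + x$1 * x$5) * (2 * (x$2 * x$6 + x$3 * x$7))
    + 2 * (x$0 * x$5 - x$1 * x$4) * (2 * (x$2 * x$7 - x$3 * x$6))"
  by (simp add: Q_def inner_vec_def sum_3)

lemma h_X_X: "h c x (X x) (X x) = N c (Q x)"
proof -
  have 1: "e x (X x) = 0"
    by (simp add: e_def X_def sum_8 axis_def)
  have 2: "e (X x) (X x) = R x"
    by (simp add: e_def R_def X_def sum_8 axis_def power2_eq_square)
  have 3: "\<alpha>1 x (X x) = norm (fst (Q x)) - norm (snd (Q x))"
    by (simp add: norm_fst_Q norm_snd_Q \<alpha>1_def e_def X_def Y1_def sum_8 axis_def power2_eq_square)
  have 4: "\<alpha>2 x (X x) = 2 * (x$1 * x$2 - x$0 * x$3 + x$5 * x$6 - x$4 * x$7)"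
    by (simp add: \<alpha>2_def e_def X_def Y2_def sum_8 axis_def algebra_simps)
  have 5: "\<alpha>3 x (X x) = 2 * (x$0 * x$2 + x$1 * x$3 + x$4 * x$6 + x$5 * x$7)"
    by (simp add: \<alpha>3_def e_def X_def Y3_def sum_8 axis_def algebra_simps)
  have 6: "R x = norm (fst (Q x)) + norm (snd (Q x))"
    by (simp add: norm_fst_Q norm_snd_Q R_def sum_8)
  have 7: "(\<alpha>2 x (X x))\<^sup>2 + (\<alpha>3 x (X x))\<^sup>2
    = 2 * norm (fst (Q x)) * norm (snd (Q x)) + 2 * (fst (Q x) \<bullet> snd (Q x))"
    unfolding 4 5 norm_fst_Q norm_snd_Q inner_Q by (rule sum_of_squares_identity)
  have "h c x (X x) (X x) = 2 * (R x)\<^sup>2 - 2 * (\<alpha>1 x (X x))\<^sup>2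
    + (1 - c) * ((\<alpha>2 x (X x))\<^sup>2 + (\<alpha>3 x (X x))\<^sup>2)"
    by (simp add: h_def d0_R 1 2 power2_eq_square)
  then show ?thesis
    unfolding 3 6 7 N_def by (simp add: power2_eq_square algebra_simps)
qed

end

theory Submission
  imports Defs
begin

text \<open>
  Put \<open>k = 1 - c\<close>. Then \<open>h\<^sub>c(X, \<cdot>) = 4 \<beta> + k \<gamma>\<close> and \<open>N\<^sub>c = 8 u v + k M\<close>, where
  \<open>\<beta> = v \<xi>\<^sub>u + u \<xi>\<^sub>v\<close>, \<open>\<gamma> = \<alpha>\<^sub>2(X) \<alpha>\<^sub>2 + \<alpha>\<^sub>3(X) \<alpha>\<^sub>3\<close>, \<open>M = \<alpha>\<^sub>2(X)\<^sup>2 + \<alpha>\<^sub>3(X)\<^sup>2\<close> do not involve \<open>c\<close>.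
  So \<open>N\<^sub>c\<^sup>2 d\<Theta>\<^sub>c\<close> is a polynomial of degree two in \<open>k\<close> whose coefficients are polynomial 2-forms on \<open>\<real>\<^sup>8\<close>.
  On the pulled back right-hand side \<open>u\<close>, \<open>v\<close> are quadratic and
  \<open>{\<^bold>u, d\<^bold>u, d\<^bold>u} = 4 u (u d\<xi>\<^sub>u - du \<and> \<xi>\<^sub>u)\<close>, so no denominators remain and the coefficients agree as
  polynomials. Since \<open>Q\<close> is surjective, and a submersion over the locus, the 2-form on the base is
  determined by its pullback; it exists because \<open>N\<^sub>c > 0\<close> there.
\<close>

unbundle cross3_syntax

section \<open>Coordinate 1-forms as bilinear maps on R^8\<close>

lemma X_nth:
  "X x $ 0 = - (x$1)" "X x $ 1 = x$0" "X x $ 2 = - (x$3)" "X x $ 3 = x$2"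
  "X x $ 4 = - (x$5)" "X x $ 5 = x$4" "X x $ 6 = - (x$7)" "X x $ 7 = x$6"
  by (simp_all add: X_def axis_def)

lemma \<alpha>_nth:
  "\<alpha>1 x a = x$0 * a$1 - x$1 * a$0 + x$3 * a$2 - x$2 * a$3
    + x$4 * a$5 - x$5 * a$4 + x$7 * a$6 - x$6 * a$7"
  "\<alpha>2 x a = x$0 * a$2 - x$2 * a$0 + x$1 * a$3 - x$3 * a$1
    + x$4 * a$6 - x$6 * a$4 + x$5 * a$7 - x$7 * a$5"
  "\<alpha>3 x a = x$0 * a$3 - x$3 * a$0 + x$2 * a$1 - x$1 * a$2
    + x$4 * a$7 - x$7 * a$4 + x$6 * a$5 - x$5 * a$6"
  by (simp_all add: \<alpha>1_def \<alpha>2_def \<alpha>3_def e_def Y1_def Y2_def Y3_def sum_8 axis_def)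

text \<open>
  The indices \<open>u\<close> and \<open>v\<close> refer to the splitting of \<open>\<real>\<^sup>8\<close> into the coordinates
  \<open>0, 1, 4, 5\<close> and \<open>2, 3, 6, 7\<close> on which \<open>\<^bold>u\<close> and \<open>\<^bold>v\<close> depend.
\<close>

definition eu :: "(real^8) form1"
  where "eu x a = x$0 * a$0 + x$1 * a$1 + x$4 * a$4 + x$5 * a$5"

definition ev :: "(real^8) form1"
  where "ev x a = x$2 * a$2 + x$3 * a$3 + x$6 * a$6 + x$7 * a$7"

definition \<xi>u :: "(real^8) form1"
  where "\<xi>u x a = x$0 * a$1 - x$1 * a$0 + x$4 * a$5 - x$5 * a$4"

definition \<xi>v :: "(real^8) form1"
  where "\<xi>v x a = x$2 * a$3 - x$3 * a$2 + x$6 * a$7 - x$7 * a$6"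

definition dQ :: "real^8 \<Rightarrow> real^8 \<Rightarrow> base"
  where "dQ x a =
    (vector [2 * (x$0 * a$0 + x$1 * a$1 - x$4 * a$4 - x$5 * a$5),
             2 * (x$0 * a$4 + x$4 * a$0 + x$1 * a$5 + x$5 * a$1),
             2 * (x$0 * a$5 + x$5 * a$0 - x$1 * a$4 - x$4 * a$1)],
     vector [2 * (x$2 * a$2 + x$3 * a$3 - x$6 * a$6 - x$7 * a$7),
             2 * (x$2 * a$6 + x$6 * a$2 + x$3 * a$7 + x$7 * a$3),
             2 * (x$2 * a$7 + x$7 * a$2 - x$3 * a$6 - x$6 * a$3)])"

text \<open>With base point and tangent vector as the two arguments of a bilinear map, the
  derivatives of the forms on R^8 reduce to the product rule.\<close>

lemma bounded_bilinear_coords: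
  "bounded_bilinear eu" "bounded_bilinear ev" "bounded_bilinear \<xi>u" "bounded_bilinear \<xi>v"
  "bounded_bilinear \<alpha>2" "bounded_bilinear \<alpha>3"
  "bounded_bilinear (\<lambda>x y. \<alpha>2 x (X y))" "bounded_bilinear (\<lambda>x y. \<alpha>3 x (X y))"
  by (auto intro!: linearI simp: bilinear_conv_bounded_bilinear[symmetric] bilinear_def
      eu_def ev_def \<xi>u_def \<xi>v_def \<alpha>_nth X_nth algebra_simps)

lemma bounded_bilinear_dQ: "bounded_bilinear dQ"
  by (auto intro!: linearI simp: bilinear_conv_bounded_bilinear[symmetric] bilinear_def
      dQ_def vec_eq_iff forall_3 algebra_simps)

lemma has_derivative_bilinear_left:
  assumes "bounded_bilinear B"
  shows "((\<lambda>x. B x y) has_derivative (\<lambda>a. B a y)) (at x)"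
  by (rule bounded_linear_imp_has_derivative[OF bounded_bilinear.bounded_linear_left[OF assms]])

lemma has_derivative_bilinear_diagonal:
  assumes "bounded_bilinear B"
  shows "((\<lambda>x. B x x) has_derivative (\<lambda>a. B x a + B a x)) (at x)"
  using bounded_bilinear.FDERIV[OF assms has_derivative_ident has_derivative_ident] .

text \<open>The entries of \<open>Q\<close> are quadratic forms, and \<open>dQ\<close> is the
  symmetric bilinear map with \<open>Q x = dQ x x / 2\<close>.\<close>

lemma has_derivative_Q: "(Q has_derivative dQ x) (at x)"
proof -
  have "Q = (\<lambda>x. (1/2) *\<^sub>R dQ x x)"
    by (auto simp: Q_def dQ_def vec_eq_iff forall_3 power2_eq_square)
  moreover have "((\<lambda>x. (1/2) *\<^sub>R dQ x x) has_derivative (\<lambda>a. (1/2) *\<^sub>R (dQ x a + dQ a x))) (at x)"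
    by (intro has_derivative_scaleR_right has_derivative_bilinear_diagonal bounded_bilinear_dQ)
  moreover have "(\<lambda>a. (1/2) *\<^sub>R (dQ x a + dQ a x)) = dQ x"
    by (auto simp: dQ_def vec_eq_iff forall_3)
  ultimately show ?thesis by simp
qed

lemma frechet_derivative_Q: "frechet_derivative Q (at x) = dQ x"
  using frechet_derivative_at[OF has_derivative_Q] by simp

section \<open>Surjectivity of the Hopf map, of \<open>Q\<close> and of its differential\<close>

lemma hopf_map_surj:
  fixes r s t :: real
  obtains a b c d where "a\<^sup>2 + b\<^sup>2 - c\<^sup>2 - d\<^sup>2 = r" "2 * (a * c + b * d) = s" "2 * (a * d - b * c) = t"
proof (cases "sqrt (r\<^sup>2 + s\<^sup>2 + t\<^sup>2) + r = 0")
  \<comment> \<open>This forces \<open>s = t = 0\<close> and \<open>r \<le> 0\<close>, where the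
    preimage of the other case would divide by \<open>m = 0\<close>.\<close>
  case True
  moreover have "0 \<le> r\<^sup>2 + s\<^sup>2 + t\<^sup>2" by simp
  then have "0 \<le> sqrt (r\<^sup>2 + s\<^sup>2 + t\<^sup>2)" by (rule real_sqrt_ge_zero)
  ultimately have "r \<le> 0" by linarith
  from True have "sqrt (r\<^sup>2 + s\<^sup>2 + t\<^sup>2) = - r" by linarith
  then have "r\<^sup>2 + s\<^sup>2 + t\<^sup>2 = (- r)\<^sup>2" by (metis real_sqrt_pow2 \<open>0 \<le> r\<^sup>2 + s\<^sup>2 + t\<^sup>2\<close>)
  then have "s\<^sup>2 + t\<^sup>2 = 0" by simp
  then have "s = 0" "t = 0" by (metis sum_power2_eq_zero_iff)+
  then show ?thesis using \<open>r \<le> 0\<close> by (intro that[of 0 0 "sqrt (- r)" 0]) simp_all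
next
  case False
  define n where "n = sqrt (r\<^sup>2 + s\<^sup>2 + t\<^sup>2)"
  have n: "n\<^sup>2 = r\<^sup>2 + s\<^sup>2 + t\<^sup>2" by (simp add: n_def)
  have "\<bar>r\<bar> \<le> n" unfolding n_def by (rule real_le_rsqrt) simp
  with False have pos: "0 < n + r" by (simp add: n_def)
  \<comment> \<open>For a preimage with \<open>b = 0\<close>, the equations
    \<open>a^2 + c^2 + d^2 = n\<close> and \<open>a^2 - c^2 - d^2 = r\<close> force
    \<open>a^2 = (n + r) / 2\<close>.\<close>
  define m where "m = sqrt ((n + r) / 2)"
  have m: "m\<^sup>2 = (n + r) / 2" "m \<noteq> 0" using pos by (simp_all add: m_def)
  have "(n + r) * (n - r) = s\<^sup>2 + t\<^sup>2" using n by algebra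
  then have "(s\<^sup>2 + t\<^sup>2) / (4 * m\<^sup>2) = (n - r) / 2"
    using pos by (simp add: m field_simps)
  moreover have "(s / (2 * m))\<^sup>2 + (t / (2 * m))\<^sup>2 = (s\<^sup>2 + t\<^sup>2) / (4 * m\<^sup>2)"
    by (simp add: power_divide power_mult_distrib add_divide_distrib)
  moreover have "(n + r) / 2 - (n - r) / 2 = r" by (simp add: field_simps)
  ultimately have "m\<^sup>2 + 0\<^sup>2 - (s / (2 * m))\<^sup>2 - (t / (2 * m))\<^sup>2 = r"
    using m(1) zero_power2[where 'a=real] by linarith
  then show ?thesis using m(2) by (intro that[of m 0 "s / (2 * m)" "t / (2 * m)"]) simp_all
qed

lemma surj_Q: "surj Q"
proof (rule surjI)
  show "Q (SOME x. Q x = p) = p" for p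
  proof (rule someI_ex)
    obtain a b c d where 1: "a\<^sup>2 + b\<^sup>2 - c\<^sup>2 - d\<^sup>2 = fst p $ 1"
      "2 * (a * c + b * d) = fst p $ 2" "2 * (a * d - b * c) = fst p $ 3"
      by (rule hopf_map_surj)
    obtain a' b' c' d' where 2: "a'\<^sup>2 + b'\<^sup>2 - c'\<^sup>2 - d'\<^sup>2 = snd p $ 1"
      "2 * (a' * c' + b' * d') = snd p $ 2" "2 * (a' * d' - b' * c') = snd p $ 3"
      by (rule hopf_map_surj)
    show "\<exists>x. Q x = p"
      by (rule exI[of _ "a *\<^sub>R pd 0 + b *\<^sub>R pd 1 + a' *\<^sub>R pd 2 + b' *\<^sub>R pd 3
          + c *\<^sub>R pd 4 + d *\<^sub>R pd 5 + c' *\<^sub>R pd 6 + d' *\<^sub>R pd 7"])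
        (use 1 2 in \<open>simp add: Q_def prod_eq_iff vec_eq_iff forall_3 axis_def\<close>)
  qed
qed

lemma norm_Q: "norm (fst (Q x)) = eu x x" "norm (snd (Q x)) = ev x x"
  by (simp_all add: norm_fst_Q norm_snd_Q eu_def ev_def power2_eq_square)

text \<open>The three rows of each block of \<open>dQ x\<close> are orthogonal, so the transpose inverts it.\<close>

lemma hopf_derivative_surj:
  fixes a b c d r s t :: real
  assumes "a * a + b * b + c * c + d * d \<noteq> 0"
  obtains a' b' c' d' where "2 * (a * a' + b * b' - c * c' - d * d') = r"
    "2 * (a * c' + c * a' + b * d' + d * b') = s"
    "2 * (a * d' + d * a' - b * c' - c * b') = t"
proof -
  define n where "n = a * a + b * b + c * c + d * d"
  have n: "n \<noteq> 0" using assms by (simp add: n_def)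
  show ?thesis
    by (rule that[of "(a * r + c * s + d * t) / (2 * n)" "(b * r + d * s - c * t) / (2 * n)"
        "(a * s - c * r - b * t) / (2 * n)" "(b * s - d * r + a * t) / (2 * n)"];
        use n in \<open>simp add: field_simps\<close>; simp add: n_def algebra_simps)
qed

lemma surj_dQ:
  assumes "eu x x \<noteq> 0" "ev x x \<noteq> 0"
  obtains a where "dQ x a = w"
proof -
  obtain a b c d where 1:
    "2 * (x$0 * a + x$1 * b - x$4 * c - x$5 * d) = fst w $ 1"
    "2 * (x$0 * c + x$4 * a + x$1 * d + x$5 * b) = fst w $ 2"
    "2 * (x$0 * d + x$5 * a - x$1 * c - x$4 * b) = fst w $ 3"
    by (rule hopf_derivative_surj[OF assms(1)[unfolded eu_def]])
  obtain a' b' c' d' where 2: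
    "2 * (x$2 * a' + x$3 * b' - x$6 * c' - x$7 * d') = snd w $ 1"
    "2 * (x$2 * c' + x$6 * a' + x$3 * d' + x$7 * b') = snd w $ 2"
    "2 * (x$2 * d' + x$7 * a' - x$3 * c' - x$6 * b') = snd w $ 3"
    by (rule hopf_derivative_surj[OF assms(2)[unfolded ev_def]])
  show ?thesis
    by (intro that[of "a *\<^sub>R pd 0 + b *\<^sub>R pd 1 + a' *\<^sub>R pd 2 + b' *\<^sub>R pd 3
        + c *\<^sub>R pd 4 + d *\<^sub>R pd 5 + c' *\<^sub>R pd 6 + d' *\<^sub>R pd 7"])
      (use 1 2 in \<open>simp add: dQ_def prod_eq_iff vec_eq_iff forall_3 axis_def\<close>)
qed

section \<open>The connection form and its exterior derivative\<close>

definition \<beta> :: "(real^8) form1"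
  where "\<beta> x a = ev x x * \<xi>u x a + eu x x * \<xi>v x a"

definition \<gamma> :: "(real^8) form1"
  where "\<gamma> x a = \<alpha>2 x (X x) * \<alpha>2 x a + \<alpha>3 x (X x) * \<alpha>3 x a"

definition M :: "real^8 \<Rightarrow> real"
  where "M x = (\<alpha>2 x (X x))\<^sup>2 + (\<alpha>3 x (X x))\<^sup>2"

lemma h_X: "h c x (X x) a = 4 * \<beta> x a + (1 - c) * \<gamma> x a"
proof -
  have "e x (X x) = 0" "e (X x) a = \<xi>u x a + \<xi>v x a"
    by (simp_all add: e_def sum_8 X_nth \<xi>u_def \<xi>v_def)
  moreover have "R x = eu x x + ev x x"
    by (simp add: R_def sum_8 eu_def ev_def power2_eq_square)
  moreover have "\<alpha>1 x a = \<xi>u x a - \<xi>v x a" "\<alpha>1 x (X x) = eu x x - ev x x"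
    by (simp_all add: \<alpha>_nth X_nth \<xi>u_def \<xi>v_def eu_def ev_def)
  ultimately show ?thesis
    unfolding h_def d0_R \<beta>_def \<gamma>_def by algebra
qed

lemma N_Q: "N c (Q x) = 8 * (eu x x * ev x x) + (1 - c) * M x"
proof -
  have "\<xi>u x (X x) = eu x x" "\<xi>v x (X x) = ev x x"
    by (simp_all add: X_nth \<xi>u_def \<xi>v_def eu_def ev_def)
  then show ?thesis
    by (simp add: h_X_X[symmetric] h_X \<beta>_def \<gamma>_def M_def power2_eq_square)
qed

lemma \<Theta>_eq: "\<Theta> c x a = 2 * (4 * \<beta> x a + (1 - c) * \<gamma> x a) / N c (Q x)"
  by (simp add: \<Theta>_def h_X h_X_X[symmetric])

definition dM :: "(real^8) form1"
  where "dM x a = 4 * (\<alpha>2 x (X x) * \<alpha>2 x (X a) + \<alpha>3 x (X x) * \<alpha>3 x (X a))"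

text \<open>
  \<open>D\<beta> x a b\<close> is the derivative of \<open>\<beta> x b\<close> in \<open>x\<close> in the direction \<open>a\<close>, so that
  \<open>d\<beta>(a, b) = D\<beta> x a b - D\<beta> x b a\<close>; likewise for \<open>D\<gamma>\<close>.
\<close>

definition D\<beta> :: "(real^8) form2"
  where "D\<beta> x a b = 2 * ev x a * \<xi>u x b + ev x x * \<xi>u a b + 2 * eu x a * \<xi>v x b + eu x x * \<xi>v a b"

definition D\<gamma> :: "(real^8) form2"
  where "D\<gamma> x a b = 2 * \<alpha>2 x (X a) * \<alpha>2 x b + \<alpha>2 x (X x) * \<alpha>2 a b
    + 2 * \<alpha>3 x (X a) * \<alpha>3 x b + \<alpha>3 x (X x) * \<alpha>3 a b"

lemma eu_ev_commute: "eu a x = eu x a" "ev a x = ev x a"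
  by (simp_all add: eu_def ev_def mult.commute)

text \<open>The skew linear map \<open>X\<close> commutes with the skew maps \<open>Y2\<close> and
  \<open>Y3\<close> (left against right quaternion multiplication), so these forms are symmetric.
  Hence the factors 2 in \<open>D\<gamma>\<close> and 4 in \<open>dM\<close>.\<close>

lemma \<alpha>_X_commute: "\<alpha>2 a (X x) = \<alpha>2 x (X a)" "\<alpha>3 a (X x) = \<alpha>3 x (X a)"
  by (simp_all add: \<alpha>_nth X_nth algebra_simps)

lemmas has_derivative_coords =
  bounded_bilinear_coords[THEN has_derivative_bilinear_left]
  bounded_bilinear_coords[THEN has_derivative_bilinear_diagonal]

lemmas has_derivative_intros = has_derivative_add has_derivative_mult has_derivative_const

lemma has_derivative_M: "(M has_derivative dM x) (at x)"
  unfolding M_def[abs_def] power2_eq_square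
  by (rule has_derivative_eq_rhs, (rule has_derivative_coords has_derivative_intros)+)
    (simp add: fun_eq_iff dM_def \<alpha>_X_commute algebra_simps)

lemma has_derivative_\<beta>: "((\<lambda>x. \<beta> x b) has_derivative (\<lambda>a. D\<beta> x a b)) (at x)"
  unfolding \<beta>_def
  by (rule has_derivative_eq_rhs, (rule has_derivative_coords has_derivative_intros)+)
    (simp add: fun_eq_iff D\<beta>_def eu_ev_commute algebra_simps)

lemma has_derivative_\<gamma>: "((\<lambda>x. \<gamma> x b) has_derivative (\<lambda>a. D\<gamma> x a b)) (at x)"
  unfolding \<gamma>_def
  by (rule has_derivative_eq_rhs, (rule has_derivative_coords has_derivative_intros)+)
    (simp add: fun_eq_iff D\<gamma>_def \<alpha>_X_commute algebra_simps)

lemma has_derivative_N_Q: "((\<lambda>x. N c (Q x)) has_derivative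
    (\<lambda>a. 16 * (eu x x * ev x a + eu x a * ev x x) + (1 - c) * dM x a)) (at x)"
  unfolding N_Q
  by (rule has_derivative_eq_rhs, (rule has_derivative_coords has_derivative_M has_derivative_intros)+)
    (simp add: fun_eq_iff eu_ev_commute algebra_simps)

text \<open>Quotient rule: for \<open>\<Theta> = 2 \<eta> / N\<close>, the form
  \<open>N^2 d\<Theta>\<close> is \<open>2 (N d\<eta> - dN \<and> \<eta>)\<close>.\<close>

lemma d1_\<Theta>:
  assumes "N c (Q x) \<noteq> 0"
  shows "(N c (Q x))\<^sup>2 * d1 (\<Theta> c) x a b =
    2 * N c (Q x) * (4 * (D\<beta> x a b - D\<beta> x b a) + (1 - c) * (D\<gamma> x a b - D\<gamma> x b a))
    - 2 * ((16 * (eu x x * ev x a + eu x a * ev x x) + (1 - c) * dM x a) * (4 * \<beta> x b + (1 - c) * \<gamma> x b)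
      - (16 * (eu x x * ev x b + eu x b * ev x x) + (1 - c) * dM x b) * (4 * \<beta> x a + (1 - c) * \<gamma> x a))"
proof -
  define n where "n = N c (Q x)"
  have n: "n \<noteq> 0" using assms by (simp add: n_def)
  define dn where "dn a = 16 * (eu x x * ev x a + eu x a * ev x x) + (1 - c) * dM x a" for a
  have "((\<lambda>x. \<Theta> c x b) has_derivative (\<lambda>a. (2 * (4 * D\<beta> x a b + (1 - c) * D\<gamma> x a b) * n
      - 2 * (4 * \<beta> x b + (1 - c) * \<gamma> x b) * dn a) / n\<^sup>2)) (at x)" for b
    unfolding \<Theta>_eq n_def dn_def
    by (rule has_derivative_eq_rhs, (rule has_derivative_\<beta> has_derivative_\<gamma> has_derivative_N_Q
        has_derivative_divide' has_derivative_intros assms)+)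
      (simp add: fun_eq_iff power2_eq_square)
  note frechet_derivative_at[OF this, symmetric]
  then have "d1 (\<Theta> c) x a b =
      (2 * (4 * D\<beta> x a b + (1 - c) * D\<gamma> x a b) * n - 2 * (4 * \<beta> x b + (1 - c) * \<gamma> x b) * dn a) / n\<^sup>2
      - (2 * (4 * D\<beta> x b a + (1 - c) * D\<gamma> x b a) * n - 2 * (4 * \<beta> x a + (1 - c) * \<gamma> x a) * dn b) / n\<^sup>2"
    by (simp add: d1_def)
  then show ?thesis
    using n unfolding n_def[symmetric] dn_def[symmetric]
    by (simp add: diff_divide_distrib[symmetric]) (simp add: algebra_simps)
qed

text \<open>Since \<open>d\<xi>u(a, b) = 2 \<xi>u a b\<close>, twice \<open>\<kappa>u\<close> is \<open>u d\<xi>u - du \<and> \<xi>u\<close>.\<close>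

definition \<kappa>u :: "(real^8) form2"
  where "\<kappa>u x a b = eu x x * \<xi>u a b - eu x a * \<xi>u x b + eu x b * \<xi>u x a"

definition \<kappa>v :: "(real^8) form2"
  where "\<kappa>v x a b = ev x x * \<xi>v a b - ev x a * \<xi>v x b + ev x b * \<xi>v x a"

text \<open>
  The pullback of \<open>du \<and> {\<^bold>u, \<^bold>v, d\<^bold>v} + u {\<^bold>v, d\<^bold>u, d\<^bold>v}\<close> for \<open>\<phi> = fst\<close>, \<open>\<psi> = snd\<close>, \<open>f = eu\<close>, since
  \<open>u = eu x x\<close> and \<open>du = 2 eu x\<close>.
\<close>

definition bracket :: "(base \<Rightarrow> real^3) \<Rightarrow> (base \<Rightarrow> real^3) \<Rightarrow> (real^8) form1 \<Rightarrow> (real^8) form2"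
  where "bracket \<phi> \<psi> f x a b =
    2 * f x a * (\<phi> (Q x) \<times> \<psi> (Q x) \<bullet> \<psi> (dQ x b)) - 2 * f x b * (\<phi> (Q x) \<times> \<psi> (Q x) \<bullet> \<psi> (dQ x a))
    + f x x * (\<psi> (Q x) \<bullet> \<phi> (dQ x a) \<times> \<psi> (dQ x b) - \<psi> (Q x) \<bullet> \<phi> (dQ x b) \<times> \<psi> (dQ x a))"

section \<open>Polynomial identities for the curvature\<close>

lemma Q_nth:
  "fst (Q x) $ 1 = (x$0)\<^sup>2 + (x$1)\<^sup>2 - (x$4)\<^sup>2 - (x$5)\<^sup>2"
  "fst (Q x) $ 2 = 2 * (x$0 * x$4 + x$1 * x$5)"
  "fst (Q x) $ 3 = 2 * (x$0 * x$5 - x$1 * x$4)"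
  "snd (Q x) $ 1 = (x$2)\<^sup>2 + (x$3)\<^sup>2 - (x$6)\<^sup>2 - (x$7)\<^sup>2"
  "snd (Q x) $ 2 = 2 * (x$2 * x$6 + x$3 * x$7)"
  "snd (Q x) $ 3 = 2 * (x$2 * x$7 - x$3 * x$6)"
  by (simp_all add: Q_def)

lemma dQ_nth:
  "fst (dQ x a) $ 1 = 2 * (x$0 * a$0 + x$1 * a$1 - x$4 * a$4 - x$5 * a$5)"
  "fst (dQ x a) $ 2 = 2 * (x$0 * a$4 + x$4 * a$0 + x$1 * a$5 + x$5 * a$1)"
  "fst (dQ x a) $ 3 = 2 * (x$0 * a$5 + x$5 * a$0 - x$1 * a$4 - x$4 * a$1)"
  "snd (dQ x a) $ 1 = 2 * (x$2 * a$2 + x$3 * a$3 - x$6 * a$6 - x$7 * a$7)"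
  "snd (dQ x a) $ 2 = 2 * (x$2 * a$6 + x$6 * a$2 + x$3 * a$7 + x$7 * a$3)"
  "snd (dQ x a) $ 3 = 2 * (x$2 * a$7 + x$7 * a$2 - x$3 * a$6 - x$6 * a$3)"
  by (simp_all add: dQ_def)

text \<open>Obtained by differentiating the squared norms of \<open>fst (Q x)\<close> and
  \<open>snd (Q x)\<close>; the factors \<open>eu x x\<close> and \<open>ev x x\<close> cancel the
  norm in \<open>d0_norm_linear\<close>.\<close>

lemma inner_Q_dQ:
  "fst (Q x) \<bullet> fst (dQ x a) = 2 * eu x x * eu x a"
  "snd (Q x) \<bullet> snd (dQ x a) = 2 * ev x x * ev x a"
  unfolding inner_vec_def sum_3 Q_nth dQ_nth eu_def ev_def inner_real_def by algebra+

text \<open>The factors \<open>eu x x\<close> and \<open>ev x x\<close> cancel the denominator in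
  the first term of \<open>G\<close>.\<close>

lemma cross_dQ:
  "fst (Q x) \<bullet> fst (dQ x a) \<times> fst (dQ x b) = 4 * eu x x * \<kappa>u x a b"
  "snd (Q x) \<bullet> snd (dQ x a) \<times> snd (dQ x b) = 4 * ev x x * \<kappa>v x a b"
  unfolding inner_vec_def sum_3 cross3_def vector_3 Q_nth dQ_nth eu_def ev_def inner_real_def
    \<kappa>u_def \<kappa>v_def \<xi>u_def \<xi>v_def
  by algebra+

text \<open>Half the coefficient of \<open>(1 - c)^2\<close> in
  \<open>N^2 d\<Theta>\<close>.\<close>

lemma curvature_coeff_2:
  "M x * (D\<gamma> x a b - D\<gamma> x b a) - (dM x a * \<gamma> x b - dM x b * \<gamma> x a) =
    2 * (bracket fst snd eu x a b + bracket snd fst ev x a b)"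
  unfolding bracket_def inner_vec_def sum_3 cross3_def vector_3 Q_nth dQ_nth eu_def ev_def inner_real_def
    M_def D\<gamma>_def dM_def \<gamma>_def \<alpha>_nth X_nth
  by algebra

text \<open>One eighth of the coefficient of \<open>1 - c\<close> in
  \<open>N^2 d\<Theta>\<close>.\<close>

lemma curvature_coeff_1:
  "2 * (eu x x * ev x x) * (D\<gamma> x a b - D\<gamma> x b a) + M x * (D\<beta> x a b - D\<beta> x b a)
    - 4 * ((eu x x * ev x a + eu x a * ev x x) * \<gamma> x b - (eu x x * ev x b + eu x b * ev x x) * \<gamma> x a)
    - (dM x a * \<beta> x b - dM x b * \<beta> x a) =
    bracket fst snd eu x a b + bracket snd fst ev x a b
    + 8 * ((ev x x)\<^sup>2 * \<kappa>u x a b + (eu x x)\<^sup>2 * \<kappa>v x a b)"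
  unfolding bracket_def inner_vec_def sum_3 cross3_def vector_3 Q_nth dQ_nth eu_def ev_def inner_real_def
    M_def D\<gamma>_def dM_def \<gamma>_def \<alpha>_nth X_nth D\<beta>_def \<beta>_def \<xi>u_def \<xi>v_def \<kappa>u_def \<kappa>v_def
  by algebra

text \<open>Both sides are compared as polynomials of degree two in \<open>1 - c\<close>.\<close>

lemma curvature:
  assumes "N c (Q x) \<noteq> 0"
  shows "(N c (Q x))\<^sup>2 * d1 (\<Theta> c) x a b =
    64 * (3 - c) * ((ev x x)\<^sup>2 * \<kappa>u x a b + (eu x x)\<^sup>2 * \<kappa>v x a b)
    + 4 * (1 - c) * (3 - c) * (bracket fst snd eu x a b + bracket snd fst ev x a b)"
    (is "?lhs = 64 * (3 - c) * ?K + 4 * (1 - c) * (3 - c) * ?B")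
proof -
  have 0: "eu x x * ev x x * (D\<beta> x a b - D\<beta> x b a)
      - 2 * ((eu x x * ev x a + eu x a * ev x x) * \<beta> x b - (eu x x * ev x b + eu x b * ev x x) * \<beta> x a)
    = 2 * ?K" (is "?E = _")
    unfolding D\<beta>_def \<beta>_def \<kappa>u_def \<kappa>v_def \<xi>u_def \<xi>v_def by algebra
  have "?lhs = 64 * ?E
      + 8 * (1 - c) * (2 * (eu x x * ev x x) * (D\<gamma> x a b - D\<gamma> x b a) + M x * (D\<beta> x a b - D\<beta> x b a)
        - 4 * ((eu x x * ev x a + eu x a * ev x x) * \<gamma> x b - (eu x x * ev x b + eu x b * ev x x) * \<gamma> x a)
        - (dM x a * \<beta> x b - dM x b * \<beta> x a))
      + 2 * (1 - c)\<^sup>2 * (M x * (D\<gamma> x a b - D\<gamma> x b a) - (dM x a * \<gamma> x b - dM x b * \<gamma> x a))"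
    unfolding d1_\<Theta>[OF assms] unfolding N_Q by algebra
  also have "\<dots> = 64 * (2 * ?K) + 8 * (1 - c) * (?B + 8 * ?K) + 2 * (1 - c)\<^sup>2 * (2 * ?B)"
    unfolding 0 curvature_coeff_2 curvature_coeff_1 ..
  \<comment> \<open>Both \<open>?K\<close> and \<open>?B\<close> acquire the factor
    \<open>3 - c = 2 + (1 - c)\<close>.\<close>
  also have "\<dots> = 64 * (3 - c) * ?K + 4 * (1 - c) * (3 - c) * ?B"
    by algebra
  finally show ?thesis .
qed

section \<open>\<open>G\<close> through scalar triple products on the base\<close>

lemma triple1_eq: "triple1 a b \<nu> p w = a p \<times> b p \<bullet> (\<chi> k. \<nu> k p w)"
  by (simp add: triple1_def eps_def sum_3 inner_vec_def cross3_def algebra_simps)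

lemma triple2_eq: "triple2 a \<mu> \<nu> p w z =
    a p \<bullet> (\<chi> j. \<mu> j p w) \<times> (\<chi> k. \<nu> k p z) - a p \<bullet> (\<chi> j. \<mu> j p z) \<times> (\<chi> k. \<nu> k p w)"
  by (simp add: triple2_def wedge_def eps_def sum_3 inner_vec_def cross3_def algebra_simps)

lemma dvec_linear:
  assumes "bounded_linear \<phi>"
  shows "dvec \<phi> i p w = \<phi> w $ i"
  using frechet_derivative_at[OF bounded_linear_imp_has_derivative[OF
      bounded_linear_compose[OF bounded_linear_vec_nth assms]], symmetric]
  by (simp add: dvec_def d0_def)

lemma d0_norm_linear:
  assumes "bounded_linear \<phi>" "\<phi> p \<noteq> 0"
  shows "d0 (\<lambda>q. norm (\<phi> q)) p w = \<phi> p \<bullet> \<phi> w / norm (\<phi> p)"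
proof -
  have "((\<lambda>q. norm (\<phi> q)) has_derivative (\<lambda>w. \<phi> w \<bullet> sgn (\<phi> p))) (at p)"
    using has_derivative_compose[OF bounded_linear_imp_has_derivative[OF assms(1)]
        has_derivative_norm[OF assms(2)]]
    by simp
  from frechet_derivative_at[OF this, symmetric] show ?thesis
    by (simp add: d0_def sgn_div_norm inner_commute divide_inverse)
qed

lemma G_linear:
  assumes "bounded_linear \<phi>" "bounded_linear \<psi>" "\<phi> p \<noteq> 0"
  shows "G c \<phi> \<psi> p w z =
    16 * (3 - c) * ((norm (\<psi> p))\<^sup>2 / norm (\<phi> p)) * (\<phi> p \<bullet> \<phi> w \<times> \<phi> z)
    + 4 * (1 - c) * (3 - c) *
      (\<phi> p \<bullet> \<phi> w / norm (\<phi> p) * (\<phi> p \<times> \<psi> p \<bullet> \<psi> z) - \<phi> p \<bullet> \<phi> z / norm (\<phi> p) * (\<phi> p \<times> \<psi> p \<bullet> \<psi> w)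
       + norm (\<phi> p) * (\<psi> p \<bullet> \<phi> w \<times> \<psi> z - \<psi> p \<bullet> \<phi> z \<times> \<psi> w))"
proof -
  \<comment> \<open>The two terms of the antisymmetrised product coincide, which turns the 8 of
    \<open>G\<close> into 16.\<close>
  have "\<phi> p \<bullet> \<phi> z \<times> \<phi> w = - (\<phi> p \<bullet> \<phi> w \<times> \<phi> z)"
    by (subst cross_skew) simp
  then show ?thesis
    by (simp add: G_def Let_def triple1_eq triple2_eq wedge_def dvec_linear d0_norm_linear assms)
qed

lemma is_form2_G:
  assumes "bounded_linear \<phi>" "bounded_linear \<psi>" "\<And>p. p \<in> S \<Longrightarrow> \<phi> p \<noteq> 0"
  shows "is_form2_on S (G c \<phi> \<psi>)"
proof -
  note lin = bounded_linear.linear[OF assms(1)] bounded_linear.linear[OF assms(2)]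
  show ?thesis
    unfolding is_form2_on_def
    by (intro ballI conjI allI linearI)
      (simp_all add: G_linear assms lin[THEN linear_add] lin[THEN linear_scale] cross_add_left
        cross_add_right cross_mult_left cross_mult_right inner_add_right add_divide_distrib algebra_simps)
qed

lemma G_Q:
  assumes "eu x x \<noteq> 0" "ev x x \<noteq> 0"
  shows "G c fst snd (Q x) (dQ x a) (dQ x b) =
      64 * (3 - c) * ((ev x x)\<^sup>2 * \<kappa>u x a b) + 4 * (1 - c) * (3 - c) * bracket fst snd eu x a b"
    and "G c snd fst (Q x) (dQ x a) (dQ x b) =
      64 * (3 - c) * ((eu x x)\<^sup>2 * \<kappa>v x a b) + 4 * (1 - c) * (3 - c) * bracket snd fst ev x a b"
proof -
  have "fst (Q x) \<noteq> 0" "snd (Q x) \<noteq> 0" using assms by (metis norm_Q norm_zero)+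
  then show "G c fst snd (Q x) (dQ x a) (dQ x b) =
      64 * (3 - c) * ((ev x x)\<^sup>2 * \<kappa>u x a b) + 4 * (1 - c) * (3 - c) * bracket fst snd eu x a b"
    and "G c snd fst (Q x) (dQ x a) (dQ x b) =
      64 * (3 - c) * ((eu x x)\<^sup>2 * \<kappa>v x a b) + 4 * (1 - c) * (3 - c) * bracket snd fst ev x a b"
    using assms
    by (simp_all add: G_linear bounded_linear_fst bounded_linear_snd norm_Q inner_Q_dQ cross_dQ bracket_def)
qed

section \<open>Positivity of \<open>N\<close> and descent to the base\<close>

lemma N_pos:
  assumes "c < 3" "p \<in> locus"
  shows "0 < N c p"
proof -
  define n where "n = norm (fst p) * norm (snd p)"
  have "0 < n" using assms(2) by (simp add: locus_def n_def)
  have ip: "\<bar>fst p \<bullet> snd p\<bar> \<le> n" unfolding n_def by (rule Cauchy_Schwarz_ineq2)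
  have "\<bar>(1 - c) * (fst p \<bullet> snd p)\<bar> \<le> \<bar>1 - c\<bar> * n"
    unfolding abs_mult by (intro mult_left_mono ip) simp
  \<comment> \<open>The gap \<open>5 - c - \<bar>1 - c\<bar>\<close> is 4 for
    \<open>c \<le> 1\<close> and \<open>6 - 2 c\<close> otherwise, positive as
    \<open>c < 3\<close>.\<close>
  moreover have "\<bar>1 - c\<bar> * n < (5 - c) * n"
    using \<open>0 < n\<close> assms(1) by (intro mult_strict_right_mono) auto
  ultimately have "0 < (5 - c) * n + (1 - c) * (fst p \<bullet> snd p)" by linarith
  then show ?thesis by (simp add: N_def n_def algebra_simps)
qed

theorem theorem5p5:
  fixes c :: real
  assumes "c < 3"
  shows "(\<exists>F. descends_to (d1 (\<Theta> c)) F) \<and>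
    (\<forall>F. descends_to (d1 (\<Theta> c)) F \<longrightarrow>
      (\<forall>p\<in>locus. \<forall>w z. (N c p)\<^sup>2 * F p w z = G c fst snd p w z + G c snd fst p w z))"
proof -
  have nz: "eu x x \<noteq> 0" "ev x x \<noteq> 0" if "Q x \<in> locus" for x
    using that by (auto simp: locus_def norm_Q[symmetric])
  have key: "(N c (Q x))\<^sup>2 * d1 (\<Theta> c) x a b =
      G c fst snd (Q x) (dQ x a) (dQ x b) + G c snd fst (Q x) (dQ x a) (dQ x b)"
    if "Q x \<in> locus" for x a b
    unfolding curvature[OF N_pos[OF assms that, THEN less_imp_neq, symmetric]] G_Q[OF nz[OF that]]
    by (simp add: algebra_simps)
  \<comment> \<open>Existence: the claimed formula, solved for the curvature, serves as the
    descended form.\<close>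
  define F where "F p w z = (G c fst snd p w z + G c snd fst p w z) / (N c p)\<^sup>2" for p w z
  have "is_form2_on locus (G c fst snd)" "is_form2_on locus (G c snd fst)"
    by (auto intro!: is_form2_G bounded_linear_fst bounded_linear_snd simp: locus_def)
  then have "is_form2_on locus F"
    by (auto simp: is_form2_on_def F_def linear_iff add_divide_distrib distrib_left)
  moreover have "pullback2 Q F x a b = d1 (\<Theta> c) x a b" if "Q x \<in> locus" for x a b
    using key[OF that, of a b] N_pos[OF assms that]
    by (simp add: pullback2_def frechet_derivative_Q F_def field_simps)
  ultimately have "descends_to (d1 (\<Theta> c)) F"
    by (auto simp: descends_to_def fun_eq_iff)
  \<comment> \<open>For an arbitrary descended form, lift the point through \<open>Q\<close> and
    both tangent vectors through \<open>dQ x\<close>, then apply \<open>key\<close>.\<close>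
  moreover have "(N c p)\<^sup>2 * F p w z = G c fst snd p w z + G c snd fst p w z"
    if F: "descends_to (d1 (\<Theta> c)) F" and p: "p \<in> locus" for F p w z
  proof -
    obtain x where x: "p = Q x" using surj_Q by (metis surjD)
    have loc: "Q x \<in> locus" using p x by simp
    obtain a b where "dQ x a = w" "dQ x b = z" using surj_dQ[OF nz[OF loc]] by metis
    moreover have "pullback2 Q F x = d1 (\<Theta> c) x" using F loc by (simp add: descends_to_def)
    then have "F (Q x) (dQ x a) (dQ x b) = d1 (\<Theta> c) x a b"
      by (simp add: pullback2_def frechet_derivative_Q fun_eq_iff)
    ultimately show ?thesis using key[OF loc, of a b] x by simp
  qed
  ultimately show ?thesis by blast
qed

end
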